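(* Let $x\in\mathbb R^{n\times d}$ be a data matrix of observations of $d$ ordered-support (count) variables, and for each $j$ let $\phi_j$ be a real-valued strictly increasing function on the support of variable $j$. Let $\phi(x)$ be the data matrix with entries $\phi_j(x_{aj})$. Then, run with the same seed, the algorithm DISCO with OCS-based parent selection returns the same graph on $\phi(x)$ as on $x$.
   Context: The algorithm DISCO with OCS-based parent selection takes a data matrix $x\in\mathbb R^{n\times d}$ and a seed, with fixed hyperparameters: number of folds $B$, a finite set of noise levels $\mathcal G_\sigma\subset(0,\infty)$, $n_{\min}\ge2$, $\tau_Z$, $\pi_{\min}$. Ties are broken by a fixed rule. Write $V=\{1,\dots,d\}$. It proceeds as follows. 1. Folds. The row indices are partitioned into folds $\mathcal I_1,\dots,\mathcal I_B$ (depending only on $n$ and the seed). For fold $b$ the training rows are those outside $\mathcal I_b$. 2. Rank transform. For each fold $b$ and coordinate $j$, let $v_{j,0}<\dots<v_{j,K_j}$ be the distinct values of coordinate $j$ in the training rows. The fitted transform $\widehat T_j$ maps $v_{j,k}$ to $k$; any held-out value below $v_{j,0}$ to $0$; any held-out value above $v_{j,K_j}$ to $K_j$; and any held-out value strictly between $v_{j,k}$ and $v_{j,k+1}$ to $\max(k,1)$. Training and held-out rows are replaced by their transformed versions, and $K=\max_jK_j$. All later steps use only the transformed data. 3. Score fitting. A fixed training routine (discrete-diffusion score-entropy training of a joint concrete-score network followed by a mask-conditioned marginal projection network), which is a deterministic function of the transformed training rows and the seed, outputs functions $\widehat\ell_{j,R}(\cdot;\sigma)$ for $j\in R\subseteq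 V$, $\sigma\in\mathcal G_\sigma$ (predicted log probability ratios for increasing coordinate $j$ by one under the marginal on $R$). Set $\widehat H_{ij,R}(x_R;\sigma)=\widehat\ell_{j,R}(x_R+e_i;\sigma)-\widehat\ell_{j,R}(x_R;\sigma)$ and $\widehat H_{j,R}=|\mathcal G_\sigma|^{-1}\sum_{\sigma\in\mathcal G_\sigma}\widehat H_{jj,R}(\cdot;\sigma)$. 4. Ordering. On each fold, using held-out transformed rows with $x_j+2\le K$, group rows by the value $v$ of coordinate $j$, with $n_v$ rows $\mathcal J_{j,v}$ in group $v$; keep $\mathcal V_j=\{v:n_v\ge n_{\min}\}$ and set $$\widehat S_j(R)=\frac1{\sum_{v\in\mathcal V_j}n_v}\sum_{v\in\mathcal V_j}n_v\,\widehat{\operatorname{Var}}\bigl(\{\widehat H_{j,R}(x_a):a\in\mathcal J_{j,v}\}\bigr)$$ ($\widehat{\operatorname{Var}}$ the sample variance), then average over folds; if $\mathcal V_j$ is empty the algorithm stops and reports this. Starting from $R=V$, while $|R|>1$, remove a minimizer of $\widehat S_j(R)$ over $j\in R$ and assign it position $|R|$; the last remaining node gets position $1$. This gives an order $\widehat\pi$. 5. Parent selection. For each $i$, let $\mathrm{Pred}_{\widehat\pi}(i)=\{j:\widehat\pi(j)<\widehat\pi(i)\}$ and $\widehat R_i=\{i\}\cup\mathrm{Pred}_{\widehat\pi}(i)$. For each fold $b$ and $j\in\mathrm{Pred}_{\widehat\pi}(i)$, $\widehat{\mathrm{OCS}}^{(b)}_{j\to i}$ is the average of $|\widehat H_{ij,\widehat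 R_i}(x_{a,\widehat R_i};\sigma)|$ over $\sigma\in\mathcal G_\sigma$ and held-out transformed rows $a\in\mathcal I_b$ with $x_{ai}+1\le K$, $x_{aj}+1\le K$ (if there are none, the algorithm stops and reports this). For nodes $i$ with at least two candidates, $Z^{(b)}_{j\to i}$ is $\widehat{\mathrm{OCS}}^{(b)}_{j\to i}$ minus the median over candidates of $i$, divided by a robust scale: the interquartile range of the candidates' estimates, or, if degenerate, successively the scaled median absolute deviation, the standard deviation, or $1$. For a single candidate, no centering is applied and the scale is the median of the robust scales of nodes with at least two candidates in that fold (or, if there are none, the robust scale of all candidate scores in that fold). Edge $j\to i$ is included in the output graph iff $B^{-1}\sum_{b=1}^B\mathbf 1\{Z^{(b)}_{j\to i}>\tau_Z\}\ge\pi_{\min}$. *)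

theory Defs
  imports Complex_Main "HOL-Library.Multiset" "HOL-Library.Disjoint_Sets"
    "Jordan_Normal_Form.Matrix"
begin

section \<open>Configuration\<close>

text \<open>
  Rows and nodes are numbered from 0, as matrix indices are, so \<open>V = {..<d}\<close>; folds and
  positions in the order are numbered from 1.

  \<open>folds n s b\<close> is fold \<open>b\<close> for sample size \<open>n\<close> and seed \<open>s\<close>. \<open>train z s j R u \<sigma>\<close> is the log ratio
  for coordinate \<open>j\<close> under the marginal on \<open>R\<close> at the state \<open>u\<close> and noise level \<open>\<sigma>\<close>, predicted by
  the network trained on the rows of \<open>z\<close> with seed \<open>s\<close>; states on \<open>R\<close> are functions that are
  \<open>undefined\<close> off \<open>R\<close>, so a prediction cannot depend on coordinates outside \<open>R\<close>.
  \<open>break_tie M\<close> picks one element of a set \<open>M\<close> of tied nodes.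
\<close>

record 'seed disco_config =
  num_folds :: nat
  folds :: "nat \<Rightarrow> 'seed \<Rightarrow> nat \<Rightarrow> nat set"
  noise_levels :: "real set"
  min_group :: nat
  z_threshold :: real
  min_freq :: real
  break_tie :: "nat set \<Rightarrow> nat"
  train :: "nat mat \<Rightarrow> 'seed \<Rightarrow> nat \<Rightarrow> nat set \<Rightarrow> (nat \<Rightarrow> nat) \<Rightarrow> real \<Rightarrow> real"

definition valid_config :: "'seed disco_config \<Rightarrow> bool" where
  "valid_config C \<longleftrightarrow>
     (\<forall>n s. (\<Union>b\<in>{1..num_folds C}. folds C n s b) = {..<n} \<and>
            disjoint_family_on (folds C n s) {1..num_folds C}) \<and>
     finite (noise_levels C) \<and> noise_levels C \<subseteq> {0<..} \<and>
     2 \<le> min_group C \<and>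
     (\<forall>M. finite M \<and> M \<noteq> {} \<longrightarrow> break_tie C M \<in> M)"

section \<open>Sample statistics\<close>

definition mean :: "real multiset \<Rightarrow> real" where
  "mean M = sum_mset M / real (size M)"

definition sample_var :: "real multiset \<Rightarrow> real" where
  "sample_var M = (\<Sum>y\<in>#M. (y - mean M)\<^sup>2) / (real (size M) - 1)"

text \<open>
  Quantiles interpolate linearly between the order statistics at 0-based ranks
  \<open>\<lfloor>p (m - 1)\<rfloor>\<close> and \<open>\<lfloor>p (m - 1)\<rfloor> + 1\<close>, where \<open>m = size M\<close>; for \<open>p = 1/2\<close> this is the usual median.
\<close>

definition quantile :: "real \<Rightarrow> real multiset \<Rightarrow> real" where
  "quantile p M =
     (let y = sorted_list_of_multiset M; h = p * (real (size M) - 1); k = nat \<lfloor>h\<rfloor>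
      in y ! k + (h - real k) * (y ! Suc k - y ! k))"

definition median :: "real multiset \<Rightarrow> real" where
  "median M = quantile (1/2) M"

definition iqr :: "real multiset \<Rightarrow> real" where
  "iqr M = quantile (3/4) M - quantile (1/4) M"

text \<open>The factor 1.4826 makes the median absolute deviation consistent for the standard
  deviation of a normal distribution.\<close>

definition scaled_mad :: "real multiset \<Rightarrow> real" where
  "scaled_mad M = 1.4826 * median (image_mset (\<lambda>y. \<bar>y - median M\<bar>) M)"

text \<open>A scale is degenerate if it is 0. For a singleton all three are 0 (the sample variance
  being \<open>0 / 0 = 0\<close>), so the robust scale is 1.\<close>

definition robust_scale :: "real multiset \<Rightarrow> real" where
  "robust_scale M =
     (if iqr M \<noteq> 0 then iqr M
      else if scaled_mad M \<noteq> 0 then scaled_mad M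
      else if sqrt (sample_var M) \<noteq> 0 then sqrt (sample_var M)
      else 1)"

section \<open>Rank transform and score fitting\<close>

definition rank_transform :: "real set \<Rightarrow> real \<Rightarrow> nat" where
  "rank_transform A y =
     (let v = sorted_list_of_set A in
      if y \<in> A then (THE k. k < length v \<and> v ! k = y)
      else if \<forall>u\<in>A. y < u then 0
      else if \<forall>u\<in>A. u < y then length v - 1
      else max (THE k. Suc k < length v \<and> v ! k < y \<and> y < v ! Suc k) 1)"

definition fitted_values :: "real mat \<Rightarrow> nat set \<Rightarrow> nat \<Rightarrow> real set" where
  "fitted_values x I j = (\<lambda>a. x $$ (a, j)) ` ({..<dim_row x} - I)"

definition transformed :: "real mat \<Rightarrow> nat set \<Rightarrow> nat mat" where
  "transformed x I =
     mat (dim_row x) (dim_col x) (\<lambda>(a, j). rank_transform (fitted_values x I j) (x $$ (a, j)))"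

definition max_rank :: "real mat \<Rightarrow> nat set \<Rightarrow> nat" where
  "max_rank x I = Max ((\<lambda>j. card (fitted_values x I j) - 1) ` {..<dim_col x})"

definition select_rows :: "'a mat \<Rightarrow> nat set \<Rightarrow> 'a mat" where
  "select_rows z A = mat_of_rows (dim_col z) (map (row z) (sorted_list_of_set A))"

text \<open>Everything after score fitting sees only the following data of each fold.\<close>

record fold_data =
  held_out :: "nat set"
  ranks :: "nat mat"
  top_rank :: nat
  score :: "nat \<Rightarrow> nat set \<Rightarrow> (nat \<Rightarrow> nat) \<Rightarrow> real \<Rightarrow> real"

definition fit_fold :: "'seed disco_config \<Rightarrow> 'seed \<Rightarrow> real mat \<Rightarrow> nat \<Rightarrow> fold_data" where
  "fit_fold C s x b =
     (let I = folds C (dim_row x) s b; z = transformed x I in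
      \<lparr> held_out = I, ranks = z, top_rank = max_rank x I,
        score = train C (select_rows z ({..<dim_row x} - I)) s \<rparr>)"

definition state :: "fold_data \<Rightarrow> nat \<Rightarrow> nat set \<Rightarrow> nat \<Rightarrow> nat" where
  "state F a R = restrict (\<lambda>k. ranks F $$ (a, k)) R"

definition score_diff ::
    "fold_data \<Rightarrow> nat \<Rightarrow> nat \<Rightarrow> nat set \<Rightarrow> (nat \<Rightarrow> nat) \<Rightarrow> real \<Rightarrow> real" where
  "score_diff F i j R u \<sigma> = score F j R (u(i := u i + 1)) \<sigma> - score F j R u \<sigma>"

definition avg_diag_diff ::
    "'seed disco_config \<Rightarrow> fold_data \<Rightarrow> nat \<Rightarrow> nat set \<Rightarrow> (nat \<Rightarrow> nat) \<Rightarrow> real" where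
  "avg_diag_diff C F j R u =
     (\<Sum>\<sigma>\<in>noise_levels C. score_diff F j j R u \<sigma>) / real (card (noise_levels C))"

section \<open>Ordering\<close>

definition group_rows :: "fold_data \<Rightarrow> nat \<Rightarrow> nat \<Rightarrow> nat set" where
  "group_rows F j v = {a \<in> held_out F. ranks F $$ (a, j) = v \<and> v + 2 \<le> top_rank F}"

definition kept_values :: "'seed disco_config \<Rightarrow> fold_data \<Rightarrow> nat \<Rightarrow> nat set" where
  "kept_values C F j = {v. min_group C \<le> card (group_rows F j v)}"

definition fold_order_score ::
    "'seed disco_config \<Rightarrow> fold_data \<Rightarrow> nat \<Rightarrow> nat set \<Rightarrow> real" where
  "fold_order_score C F j R =
     (\<Sum>v\<in>kept_values C F j. real (card (group_rows F j v)) *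
        sample_var (image_mset (\<lambda>a. avg_diag_diff C F j R (state F a R))
                      (mset_set (group_rows F j v))))
     / (\<Sum>v\<in>kept_values C F j. real (card (group_rows F j v)))"

definition order_score ::
    "'seed disco_config \<Rightarrow> (nat \<Rightarrow> fold_data) \<Rightarrow> nat \<Rightarrow> nat set \<Rightarrow> real" where
  "order_score C D j R =
     (\<Sum>b=1..num_folds C. fold_order_score C (D b) j R) / real (num_folds C)"

text \<open>\<open>positions S t m R\<close> is the position assignment produced by backward elimination from a set
  \<open>R\<close> of \<open>m\<close> nodes, with criterion \<open>S\<close> and tie rule \<open>t\<close>.\<close>

fun positions ::
    "(nat \<Rightarrow> nat set \<Rightarrow> real) \<Rightarrow> (nat set \<Rightarrow> nat) \<Rightarrow> nat \<Rightarrow> nat set \<Rightarrow> nat \<Rightarrow> nat" where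
  "positions S t (Suc (Suc m)) R =
     (let j = t {j \<in> R. \<forall>k\<in>R. S j R \<le> S k R}
      in (positions S t (Suc m) (R - {j}))(j := Suc (Suc m)))"
| "positions S t m R = (\<lambda>_. 1)"

definition node_positions ::
    "'seed disco_config \<Rightarrow> (nat \<Rightarrow> fold_data) \<Rightarrow> nat \<Rightarrow> nat \<Rightarrow> nat" where
  "node_positions C D d = positions (order_score C D) (break_tie C) d {..<d}"

text \<open>The groups do not depend on \<open>R\<close> and the first elimination round, which takes place
  iff \<open>d > 1\<close>, inspects every node; so these are all the ways in which the ordering can fail.\<close>

definition ordering_failures ::
    "'seed disco_config \<Rightarrow> (nat \<Rightarrow> fold_data) \<Rightarrow> nat \<Rightarrow> (nat \<times> nat) set" where
  "ordering_failures C D d =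
     {(b, j). d > 1 \<and> b \<in> {1..num_folds C} \<and> j < d \<and> kept_values C (D b) j = {}}"

section \<open>Parent selection\<close>

definition preds :: "nat \<Rightarrow> (nat \<Rightarrow> nat) \<Rightarrow> nat \<Rightarrow> nat set" where
  "preds d \<pi> i = {j. j < d \<and> \<pi> j < \<pi> i}"

definition ocs_rows :: "fold_data \<Rightarrow> nat \<Rightarrow> nat \<Rightarrow> nat set" where
  "ocs_rows F i j =
     {a \<in> held_out F. ranks F $$ (a, i) + 1 \<le> top_rank F \<and> ranks F $$ (a, j) + 1 \<le> top_rank F}"

definition ocs ::
    "'seed disco_config \<Rightarrow> fold_data \<Rightarrow> nat \<Rightarrow> (nat \<Rightarrow> nat) \<Rightarrow> nat \<Rightarrow> nat \<Rightarrow> real" where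
  "ocs C F d \<pi> i j =
     (let R = insert i (preds d \<pi> i) in
      (\<Sum>\<sigma>\<in>noise_levels C. \<Sum>a\<in>ocs_rows F i j. \<bar>score_diff F i j R (state F a R) \<sigma>\<bar>)
      / (real (card (noise_levels C)) * real (card (ocs_rows F i j))))"

definition candidate_scores ::
    "'seed disco_config \<Rightarrow> fold_data \<Rightarrow> nat \<Rightarrow> (nat \<Rightarrow> nat) \<Rightarrow> nat \<Rightarrow> real multiset" where
  "candidate_scores C F d \<pi> i = image_mset (ocs C F d \<pi> i) (mset_set (preds d \<pi> i))"

definition pooled_scale ::
    "'seed disco_config \<Rightarrow> fold_data \<Rightarrow> nat \<Rightarrow> (nat \<Rightarrow> nat) \<Rightarrow> real" where
  "pooled_scale C F d \<pi> =
     (let M = {i. i < d \<and> 2 \<le> card (preds d \<pi> i)} in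
      if M = {} then robust_scale (\<Sum>i<d. candidate_scores C F d \<pi> i)
      else median (image_mset (\<lambda>i. robust_scale (candidate_scores C F d \<pi> i)) (mset_set M)))"

definition z_score ::
    "'seed disco_config \<Rightarrow> fold_data \<Rightarrow> nat \<Rightarrow> (nat \<Rightarrow> nat) \<Rightarrow> nat \<Rightarrow> nat \<Rightarrow> real" where
  "z_score C F d \<pi> i j =
     (let M = candidate_scores C F d \<pi> i in
      if 2 \<le> card (preds d \<pi> i) then (ocs C F d \<pi> i j - median M) / robust_scale M
      else ocs C F d \<pi> i j / pooled_scale C F d \<pi>)"

definition ocs_failures ::
    "'seed disco_config \<Rightarrow> (nat \<Rightarrow> fold_data) \<Rightarrow> nat \<Rightarrow> (nat \<Rightarrow> nat) \<Rightarrow> (nat \<times> nat \<times> nat) set" where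
  "ocs_failures C D d \<pi> =
     {(b, j, i). b \<in> {1..num_folds C} \<and> i < d \<and> j \<in> preds d \<pi> i \<and> ocs_rows (D b) i j = {}}"

definition edges ::
    "'seed disco_config \<Rightarrow> (nat \<Rightarrow> fold_data) \<Rightarrow> nat \<Rightarrow> (nat \<Rightarrow> nat) \<Rightarrow> (nat \<times> nat) set" where
  "edges C D d \<pi> =
     {(j, i). i < d \<and> j \<in> preds d \<pi> i \<and>
        min_freq C \<le> (\<Sum>b=1..num_folds C. of_bool (z_threshold C < z_score C (D b) d \<pi> i j))
                        / real (num_folds C)}"

section \<open>The algorithm\<close>

text \<open>\<open>Graph V E\<close> has nodes \<open>V\<close> and an edge from \<open>j\<close> to \<open>i\<close> for each \<open>(j, i) \<in> E\<close>. The other two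
  outcomes report where the algorithm had to stop: at pairs (fold, node) without a kept group, or
  at triples (fold, candidate parent, node) without a usable held-out row.\<close>

datatype disco_result =
    Graph "nat set" "(nat \<times> nat) set"
  | No_Kept_Group "(nat \<times> nat) set"
  | No_Usable_Row "(nat \<times> nat \<times> nat) set"

definition disco :: "'seed disco_config \<Rightarrow> 'seed \<Rightarrow> real mat \<Rightarrow> disco_result" where
  "disco C s x =
     (let d = dim_col x; D = fit_fold C s x; \<pi> = node_positions C D d in
      if ordering_failures C D d \<noteq> {} then No_Kept_Group (ordering_failures C D d)
      else if ocs_failures C D d \<pi> \<noteq> {} then No_Usable_Row (ocs_failures C D d \<pi>)
      else Graph {..<d} (edges C D d \<pi>))"

definition transform_columns :: "(nat \<Rightarrow> real \<Rightarrow> real) \<Rightarrow> real mat \<Rightarrow> real mat" where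
  "transform_columns \<phi> x = mat (dim_row x) (dim_col x) (\<lambda>(a, j). \<phi> j (x $$ (a, j)))"

end

theory Submission
  imports Defs
begin

text \<open>
  The algorithm reads the data only through the transformed folds, and the rank transform uses only
  comparisons between the values of one coordinate. A strictly increasing function preserves these
  comparisons, so each fold, with its top rank and its fitted scores, is literally unchanged.
\<close>

lemma sorted_list_of_set_image_strict_mono:
  fixes f :: "'a::linorder \<Rightarrow> 'b::linorder"
  assumes "finite A" and "strict_mono_on A f"
  shows "sorted_list_of_set (f ` A) = map f (sorted_list_of_set A)"
proof (rule sorted_list_of_set.idem_if_sorted_distinct[of "map f (sorted_list_of_set A)",
      unfolded set_map set_sorted_list_of_set[OF assms(1)]])
  have "mono_on A f"
    using assms(2) by (rule strict_mono_on_imp_mono_on)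
  then show "sorted (map f (sorted_list_of_set A))"
    using assms(1) unfolding sorted_map
    by (intro sorted_wrt_mono_rel[OF _ sorted_sorted_list_of_set]) (auto dest: mono_onD)
  show "distinct (map f (sorted_list_of_set A))"
    using assms by (simp add: distinct_map strict_mono_on_imp_inj_on)
qed

text \<open>Monotonicity is assumed on \<open>insert y A\<close> because a held-out \<open>y\<close>
  may lie outside the training values \<open>A\<close>. Each branch condition and each predicate
  under \<open>THE\<close> is equivalent to its image under \<open>f\<close>.\<close>

lemma rank_transform_strict_mono:
  assumes "finite A" and f: "strict_mono_on (insert y A) f"
  shows "rank_transform (f ` A) (f y) = rank_transform A y"
proof -
  let ?v = "sorted_list_of_set A"
  have v: "sorted_list_of_set (f ` A) = map f ?v"
    using assms by (auto intro: sorted_list_of_set_image_strict_mono monotone_on_subset)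
  have nth: "?v ! k \<in> insert y A" if "k < length ?v" for k
    using nth_mem[OF that] assms(1) by simp
  have less: "f u < f w \<longleftrightarrow> u < w" and eq: "f u = f w \<longleftrightarrow> u = w"
    if "u \<in> insert y A" "w \<in> insert y A" for u w
    using that strict_mono_on_less[OF f] strict_mono_on_eq[OF f] by blast+
  have mem: "f y \<in> f ` A \<longleftrightarrow> y \<in> A"
    using eq by blast
  have below: "(\<forall>u\<in>f ` A. f y < u) \<longleftrightarrow> (\<forall>u\<in>A. y < u)"
    and above: "(\<forall>u\<in>f ` A. u < f y) \<longleftrightarrow> (\<forall>u\<in>A. u < y)"
    using less by auto
  \<comment> \<open>The index bound stays inside the equivalence: \<open>nth\<close> needs it, and
    the whole predicate can then be rewritten under \<open>THE\<close>.\<close>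
  have at: "k < length ?v \<and> map f ?v ! k = f y \<longleftrightarrow> k < length ?v \<and> ?v ! k = y" for k
    using eq[OF nth] by auto
  have between: "Suc k < length ?v \<and> map f ?v ! k < f y \<and> f y < map f ?v ! Suc k \<longleftrightarrow>
      Suc k < length ?v \<and> ?v ! k < y \<and> y < ?v ! Suc k" for k
    using less[OF nth] less[OF _ nth] by (auto dest: Suc_lessD)
  show ?thesis
    unfolding rank_transform_def Let_def v mem below above length_map at between ..
qed

lemma fitted_values_transform_columns:
  assumes "j < dim_col x"
  shows "fitted_values (transform_columns \<phi> x) I j = \<phi> j ` fitted_values x I j"
  using assms by (auto simp: fitted_values_def transform_columns_def image_image)

lemma fit_fold_transform_columns:
  assumes mono: "\<And>j. j < dim_col x \<Longrightarrow> strict_mono_on ((\<lambda>a. x $$ (a, j)) ` {..<dim_row x}) (\<phi> j)"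
  shows "fit_fold C s (transform_columns \<phi> x) = fit_fold C s x"
proof -
  have dim: "dim_row (transform_columns \<phi> x) = dim_row x"
    "dim_col (transform_columns \<phi> x) = dim_col x"
    by (simp_all add: transform_columns_def)
  \<comment> \<open>Here \<open>a\<close> ranges over training and held-out rows alike, so
    monotonicity is used on the whole column.\<close>
  have "rank_transform (\<phi> j ` fitted_values x I j) (\<phi> j (x $$ (a, j))) =
      rank_transform (fitted_values x I j) (x $$ (a, j))"
    if "a < dim_row x" "j < dim_col x" for I a j
    using that
    by (intro rank_transform_strict_mono monotone_on_subset[OF mono])
      (auto simp: fitted_values_def)
  then have transformed: "transformed (transform_columns \<phi> x) I = transformed x I" for I
    \<comment> \<open>\<open>transform_columns\<close> is unfolded only in the second call, since
      unfolding it earlier would hide the left-hand side of the rule for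
      \<open>fitted_values\<close>.\<close>
    by (intro eq_matI)
      (simp_all add: transformed_def dim fitted_values_transform_columns,
        simp add: transform_columns_def)
  \<comment> \<open>The top rank depends only on the numbers of distinct training values, which
    injectivity preserves.\<close>
  have "card (\<phi> j ` fitted_values x I j) = card (fitted_values x I j)" if "j < dim_col x" for I j
    using that
    by (intro card_image strict_mono_on_imp_inj_on monotone_on_subset[OF mono])
      (auto simp: fitted_values_def)
  then have "max_rank (transform_columns \<phi> x) I = max_rank x I" for I
    by (simp add: max_rank_def dim fitted_values_transform_columns cong: image_cong_simp)
  with transformed show ?thesis
    by (auto simp: fit_fold_def dim fun_eq_iff)
qed

theorem proposition12:
  fixes C :: "'seed disco_config" and s :: 'seed
    and n d :: nat and x :: "real mat"
    and supp :: "nat \<Rightarrow> real set" and \<phi> :: "nat \<Rightarrow> real \<Rightarrow> real"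
  assumes "valid_config C"
    and "x \<in> carrier_mat n d"
    and "\<And>a j. a < n \<Longrightarrow> j < d \<Longrightarrow> x $$ (a, j) \<in> supp j"
    and "\<And>j. j < d \<Longrightarrow> strict_mono_on (supp j) (\<phi> j)"
  shows "disco C s (transform_columns \<phi> x) = disco C s x"
proof -
  have "strict_mono_on ((\<lambda>a. x $$ (a, j)) ` {..<dim_row x}) (\<phi> j)" if "j < dim_col x" for j
    using that assms(2,3) by (intro monotone_on_subset[OF assms(4)]) auto
  then have "fit_fold C s (transform_columns \<phi> x) = fit_fold C s x"
    by (rule fit_fold_transform_columns)
  moreover have "dim_col (transform_columns \<phi> x) = dim_col x"
    by (simp add: transform_columns_def)
  \<comment> \<open>Apart from \<open>dim_col x\<close>, \<open>disco\<close> uses the matrix only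
    in \<open>fit_fold C s x\<close>; hence failure reports agree as well as graphs.\<close>
  ultimately show ?thesis
    by (simp add: disco_def)
qed

end
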